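(* Let $q\in H^{-1}_{per}(\mathbb{R},\mathbb{R})$ with $\widehat{q}(0)=0$. Then the quasi-differential operator $S(q):=S_{max}(q)$ coincides with the form-sum operator $S_{form}(q)=-\frac{d^2}{dx^2}\dotplus q(x)$ on $L_2(\mathbb{R})$.
   Context: $H^{-1}_{per}(\mathbb{R},\mathbb{R})$: real-valued $1$-periodic distributions $q=\sum_{k\in 2\mathbb{Z}}\widehat{q}(k)e^{ik\pi x}$ with $\sum_{k}(1+|k|)^{-2}|\widehat{q}(k)|^2<\infty$, $\widehat{q}(k)=\overline{\widehat{q}(-k)}$. Standing assumption: $\widehat{q}(0)=0$; $Q(x)=\sum_{k\in2\mathbb{Z}\setminus\{0\}}\frac{\widehat{q}(k)}{ik\pi}e^{ik\pi x}$ is real, $1$-periodic, locally square integrable, with $Q'=q$ distributionally. $l_Q[u]:=-(u'-Qu)'-Q(u'-Qu)-Q^2u$, and $S_{max}(q)u=l_Q[u]$ on $\{u\in L_2(\mathbb{R}): u,\,u'-Qu\in W^1_{1,loc}(\mathbb{R}),\,l_Q[u]\in L_2(\mathbb{R})\}$. The form-sum operator $S_{form}(q)$ is the self-adjoint lower semibounded operator associated (First Representation Theorem of Kato) with the densely defined, closed, lower semibounded sesquilinear form $\tau[u,v]=\langle -u'',v\rangle_{L_2(\mathbb{R})}+\langle qu,v\rangle_{L_2(\mathbb{R})}$, $\mathrm{Dom}(\tau)=H^1(\mathbb{R})$, where $\langle\cdot,\cdot\rangle_{L_2(\mathbb{R})}$ denotes the extension by continuity of the $L_2(\mathbb{R})$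 inner product to the duality between $H^s(\mathbb{R})$ and $H^{-s}(\mathbb{R})$; for $u,v\in H^1(\mathbb{R})$ it equals $(u',v')-(Qu,v')-(Qu',v)$. *)

theory Defs
  imports "HOL-Analysis.Analysis"
begin

text \<open>Functions on the real line are complex valued; elements of L2(R) are represented
by functions, all conditions being invariant under modification on null sets.\<close>

definition L2 :: "(real \<Rightarrow> complex) \<Rightarrow> bool" where
  "L2 f \<longleftrightarrow> f \<in> borel_measurable lebesgue \<and> integrable lebesgue (\<lambda>x. (cmod (f x))\<^sup>2)"

definition ip :: "(real \<Rightarrow> complex) \<Rightarrow> (real \<Rightarrow> complex) \<Rightarrow> complex" where
  "ip f g = integral\<^sup>L lebesgue (\<lambda>x. f x * cnj (g x))"

definition AC_deriv :: "(real \<Rightarrow> complex) \<Rightarrow> (real \<Rightarrow> complex) \<Rightarrow> bool" where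
  "AC_deriv y w \<longleftrightarrow> (\<forall>a b. w absolutely_integrable_on {a..b}) \<and>
     (\<forall>a b. a \<le> b \<longrightarrow> y b - y a = integral {a..b} w)"

definition H1_deriv :: "(real \<Rightarrow> complex) \<Rightarrow> (real \<Rightarrow> complex) \<Rightarrow> bool" where
  "H1_deriv u u' \<longleftrightarrow> L2 u \<and> L2 u' \<and> (\<exists>g. AC_deriv g u' \<and> (AE x in lebesgue. u x = g x))"

text \<open>Real 1-periodic distribution q in H^{-1}_per given by its Fourier coefficients
  qh k = \<widehat>q(k), k in 2Z (values at odd k are irrelevant).\<close>
definition Hm1_per_real :: "(int \<Rightarrow> complex) \<Rightarrow> bool" where
  "Hm1_per_real qh \<longleftrightarrow>
     (\<lambda>k. (cmod (qh k))\<^sup>2 / (1 + \<bar>real_of_int k\<bar>)\<^sup>2) summable_on {k. even k} \<and>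
     (\<forall>k. even k \<longrightarrow> qh (-k) = cnj (qh k))"

definition Q_partial :: "(int \<Rightarrow> complex) \<Rightarrow> nat \<Rightarrow> real \<Rightarrow> complex" where
  "Q_partial qh N x = (\<Sum>k\<in>{k. even k \<and> k \<noteq> 0 \<and> \<bar>k\<bar> \<le> int N}.
      qh k / (\<i> * of_int k * of_real pi) * exp (\<i> * of_int k * of_real pi * of_real x))"

definition is_Q :: "(int \<Rightarrow> complex) \<Rightarrow> (real \<Rightarrow> real) \<Rightarrow> bool" where
  "is_Q qh Q \<longleftrightarrow> (\<forall>x. Q (x + 1) = Q x) \<and> Q \<in> borel_measurable lebesgue \<and>
     (\<lambda>x. (Q x)\<^sup>2) integrable_on {0..1} \<and>
     (\<lambda>N. integral {0..1} (\<lambda>x. (cmod (complex_of_real (Q x) - Q_partial qh N x))\<^sup>2))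
        \<longlonglongrightarrow> 0"

text \<open>Graph of S_max(q): u, u'-Qu in W^1_{1,loc}, f = l_Q[u] in L2.
  y0 is the AC representative of u, w0 = u', y1 = u' - Qu (AC representative), w1 = (u'-Qu)'.\<close>
definition Smax_graph :: "(real \<Rightarrow> real) \<Rightarrow> ((real \<Rightarrow> complex) \<times> (real \<Rightarrow> complex)) set" where
  "Smax_graph Q = {(u, f). L2 u \<and> L2 f \<and>
     (\<exists>y0 w0 y1 w1. AC_deriv y0 w0 \<and> AC_deriv y1 w1 \<and>
        (AE x in lebesgue. u x = y0 x) \<and>
        (AE x in lebesgue. y1 x = w0 x - complex_of_real (Q x) * y0 x) \<and>
        (AE x in lebesgue. f x = - w1 x - complex_of_real (Q x) * y1 x
                                 - (complex_of_real (Q x))\<^sup>2 * y0 x))}"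

definition tau :: "(real \<Rightarrow> real) \<Rightarrow> (real \<Rightarrow> complex) \<Rightarrow> (real \<Rightarrow> complex)
    \<Rightarrow> (real \<Rightarrow> complex) \<Rightarrow> (real \<Rightarrow> complex) \<Rightarrow> complex" where
  "tau Q u u' v v' = ip u' v' - ip (\<lambda>x. complex_of_real (Q x) * u x) v'
                     - ip (\<lambda>x. complex_of_real (Q x) * u' x) v"

text \<open>Graph of the operator associated with tau (First Representation Theorem):
  u in Dom(tau), f in L2 with tau[u,v] = (f,v) for all v in Dom(tau) = H^1(R).\<close>
definition Sform_graph :: "(real \<Rightarrow> real) \<Rightarrow> ((real \<Rightarrow> complex) \<times> (real \<Rightarrow> complex)) set" where
  "Sform_graph Q = {(u, f). L2 f \<and>
     (\<exists>u'. H1_deriv u u' \<and> (\<forall>v v'. H1_deriv v v' \<longrightarrow> tau Q u u' v v' = ip f v))}"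

end

theory Submission
  imports Defs
begin

text \<open>Let \<open>K\<close> be the mean of \<open>Q\<^sup>2\<close> over a period. Then \<open>Q\<^sup>2 - K\<close> has a bounded primitive \<open>P\<close>, so
  integration by parts turns \<open>\<integral> Q\<^sup>2 \<bar>\<phi>u\<bar>\<^sup>2\<close> into \<open>K \<integral> \<bar>\<phi>u\<bar>\<^sup>2 - \<integral> P (\<bar>\<phi>u\<bar>\<^sup>2)'\<close>; hence \<open>Q u\<close> is form-small
  relative to \<open>u'\<close>. If \<open>S\<^sub>m\<^sub>a\<^sub>x u = f\<close>, testing this equation against \<open>\<phi>\<^sup>2 u\<close> with cutoffs \<open>\<phi>\<close> exhausting the line
  therefore bounds \<open>\<integral> \<bar>\<phi>u'\<bar>\<^sup>2\<close> uniformly, so that \<open>u \<in> H\<^sup>1\<close>, and testing against \<open>\<phi> v\<close> gives \<open>\<tau>[u, v] = (f, v)\<close>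
  in the limit. Conversely, the form identity for compactly supported \<open>v\<close> says that \<open>u' - Q u\<close> has the weak
  derivative \<open>- f - Q u'\<close>, which is locally integrable.\<close>

section \<open>Absolutely continuous functions\<close>

lemma AC_derivD:
  assumes "AC_deriv y w"
  shows "w absolutely_integrable_on {a..b}" "w integrable_on {a..b}"
    and "a \<le> b \<Longrightarrow> (w has_integral (y b - y a)) {a..b}"
proof -
  show *: "w absolutely_integrable_on {a..b}" for a b
    using assms by (auto simp: AC_deriv_def)
  then show "w integrable_on {a..b}"
    using absolutely_integrable_on_def by blast
  then show "(w has_integral (y b - y a)) {a..b}" if "a \<le> b"
    using assms that by (metis AC_deriv_def integrable_integral)
qed

lemma AC_derivI:
  assumes "\<And>a b. w absolutely_integrable_on {a..b}"
    and "\<And>a b. a \<le> b \<Longrightarrow> (w has_integral (y b - y a)) {a..b}"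
  shows "AC_deriv y w"
  using assms unfolding AC_deriv_def by (metis integral_unique)

lemma AC_deriv_continuous:
  assumes "AC_deriv y w"
  shows "continuous_on S y"
proof -
  have "isCont y x" for x
  proof -
    have "continuous_on {x-1..x+1} (\<lambda>t. y (x-1) + integral {x-1..t} w)"
      by (intro continuous_intros indefinite_integral_continuous_1 AC_derivD(2)[OF assms])
    moreover have "y (x-1) + integral {x-1..t} w = y t" if "t \<in> {x-1..x+1}" for t
      using integral_unique[OF AC_derivD(3)[OF assms, of "x-1" t]] that by auto
    ultimately have "continuous_on {x-1..x+1} y"
      by (metis (no_types, lifting) continuous_on_cong)
    then have "continuous_on {x-1<..<x+1} y"
      by (rule continuous_on_subset) auto
    then show ?thesis
      by (auto simp: continuous_on_eq_continuous_at)
  qed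
  then show ?thesis
    by (simp add: continuous_at_imp_continuous_on)
qed

lemma AC_deriv_measurable:
  assumes "AC_deriv y w"
  shows "y \<in> borel_measurable lebesgue"
  using borel_measurable_continuous_onI[OF AC_deriv_continuous[OF assms]]
  by (simp add: measurable_completion)

lemma AC_deriv_exists:
  assumes "\<And>a b. w absolutely_integrable_on {a..b}"
  shows "\<exists>y. AC_deriv y w \<and> y 0 = 0"
proof -
  define y where "y x = (if 0 \<le> x then integral {0..x} w else - integral {x..0} w)" for x :: real
  have int: "w integrable_on {a..b}" for a b
    using assms absolutely_integrable_on_def by blast
  have "integral {a..b} w = y b - y a" if "a \<le> b" for a b
  proof -
    consider "0 \<le> a" | "a < 0" "0 \<le> b" | "b < 0" by linarith
    then show ?thesis
      using that Henstock_Kurzweil_Integration.integral_combine[of 0 a b w]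
        Henstock_Kurzweil_Integration.integral_combine[of a 0 b w]
        Henstock_Kurzweil_Integration.integral_combine[of a b 0 w] int
      by cases (auto simp: y_def algebra_simps)
  qed
  moreover have "y 0 = 0" by (simp add: y_def)
  ultimately show ?thesis
    using assms unfolding AC_deriv_def by (intro exI[of _ y]) auto
qed

lemma AC_deriv_add:
  assumes "AC_deriv y w" "AC_deriv z v"
  shows "AC_deriv (\<lambda>x. y x + z x) (\<lambda>x. w x + v x)"
proof (rule AC_derivI)
  show "(\<lambda>x. w x + v x) absolutely_integrable_on {a..b}" for a b
    using AC_derivD(1)[OF assms(1)] AC_derivD(1)[OF assms(2)] by (rule set_integral_add(1))
  show "((\<lambda>x. w x + v x) has_integral (y b + z b - (y a + z a))) {a..b}" if "a \<le> b" for a b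
    using has_integral_add[OF AC_derivD(3)[OF assms(1) that] AC_derivD(3)[OF assms(2) that]]
    by (simp add: algebra_simps)
qed

lemma AC_deriv_const: "AC_deriv (\<lambda>x. c) (\<lambda>x. 0)"
  by (rule AC_derivI) auto

text \<open>The map \<open>h\<close> is linear over the reals, which covers complex conjugation as
  well as negation.\<close>

lemma AC_deriv_linear:
  assumes "AC_deriv y w" "bounded_linear h"
  shows "AC_deriv (\<lambda>x. h (y x)) (\<lambda>x. h (w x))"
proof (rule AC_derivI)
  show "(\<lambda>x. h (w x)) absolutely_integrable_on {a..b}" for a b
    using absolutely_integrable_linear[OF AC_derivD(1)[OF assms(1)] assms(2)] by (simp add: o_def)
  show "((\<lambda>x. h (w x)) has_integral (h (y b) - h (y a))) {a..b}" if "a \<le> b" for a b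
    using has_integral_linear[OF AC_derivD(3)[OF assms(1) that] assms(2)]
    by (simp add: o_def bounded_linear.linear[OF assms(2), THEN linear_diff])
qed

lemmas AC_deriv_cnj = AC_deriv_linear[OF _ bounded_linear_cnj]

section \<open>Integration by parts for absolutely continuous functions\<close>

text \<open>A bound on short intervals spreads to long ones: \<open>e\<close> is subadditive and
  \<open>m\<close> superadditive under concatenation, so induction on the number of pieces of length
  \<delta> adds the local bounds up. It serves to globalise the local error estimate for the product
  rule.\<close>

lemma interval_function_bound:
  fixes e m :: "real \<Rightarrow> real \<Rightarrow> real"
  assumes "\<delta> > 0"
    and short: "\<And>s t. \<lbrakk>a \<le> s; s \<le> t; t \<le> b; t - s \<le> \<delta>\<rbrakk> \<Longrightarrow> e s t \<le> m s t"
    and e: "\<And>r s t. \<lbrakk>a \<le> r; r \<le> s; s \<le> t; t \<le> b\<rbrakk> \<Longrightarrow> e r t \<le> e r s + e s t"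
    and m: "\<And>r s t. \<lbrakk>a \<le> r; r \<le> s; s \<le> t; t \<le> b\<rbrakk> \<Longrightarrow> m r s + m s t \<le> m r t"
    and "a \<le> b"
  shows "e a b \<le> m a b"
proof -
  have "e a t \<le> m a t" if "a \<le> t" "t \<le> b" "t - a \<le> real (Suc n) * \<delta>" for n t
    using that
  proof (induction n arbitrary: t)
    case 0
    then show ?case using short[of a t] by simp
  next
    case (Suc n)
    \<comment> \<open>The last piece \<open>{s..t}\<close> is split off; the maximum keeps
      \<open>s\<close> inside the interval when less than \<delta> remains.\<close>
    define s where "s = max a (t - \<delta>)"
    have s: "a \<le> s" "s \<le> t" "t - s \<le> \<delta>" "s \<le> b" "s - a \<le> real (Suc n) * \<delta>"
      using Suc.prems \<open>\<delta> > 0\<close> by (auto simp: s_def algebra_simps max_def)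
    show ?case
      using Suc.IH[of s] short[of s t] e[of a s t] m[of a s t] s Suc.prems by linarith
  qed
  moreover obtain n where "(b - a) / \<delta> \<le> real n"
    using real_arch_simple by blast
  then have "b - a \<le> real (Suc n) * \<delta>"
    using \<open>\<delta> > 0\<close> by (simp add: field_simps)
  ultimately show ?thesis
    using \<open>a \<le> b\<close> by blast
qed

lemma absolutely_integrable_mult_continuous:
  fixes f g :: "real \<Rightarrow> complex"
  assumes "f absolutely_integrable_on {a..b}" "continuous_on {a..b} g"
  shows "(\<lambda>x. g x * f x) absolutely_integrable_on {a..b}"
proof (rule absolutely_integrable_bounded_measurable_product[where h = "(*)" and f = g, OF _ _ _ _ assms(1)])
  show "bilinear ((*) :: complex \<Rightarrow> complex \<Rightarrow> complex)"
    by (rule bilinear_times)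
  show "g \<in> borel_measurable (lebesgue_on {a..b})"
    using assms(2) by (simp add: continuous_imp_measurable_on_sets_lebesgue)
  show "bounded (g ` {a..b})"
    using assms(2) by (simp add: compact_continuous_image compact_imp_bounded)
qed auto

text \<open>No differentiation almost everywhere is involved. The defect \<open>E\<close> of the
  product formula is additive over intervals, and where both factors oscillate by at most \<epsilon>
  it is at most \<epsilon> times the integral \<open>M\<close> of
  \<open>norm (w x) + norm (v x)\<close>. Uniform continuity supplies such short intervals, and
  \<epsilon> is arbitrary.\<close>

lemma AC_deriv_mult:
  assumes y: "AC_deriv y w" and z: "AC_deriv z v"
  shows "AC_deriv (\<lambda>x. y x * z x) (\<lambda>x. w x * z x + y x * v x)"
proof (rule AC_derivI)
  let ?p = "\<lambda>x. w x * z x + y x * v x"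
  have absp: "?p absolutely_integrable_on {a..b}" for a b
    using absolutely_integrable_mult_continuous[OF AC_derivD(1)[OF y] AC_deriv_continuous[OF z], of a b]
      absolutely_integrable_mult_continuous[OF AC_derivD(1)[OF z] AC_deriv_continuous[OF y], of a b]
    by (intro set_integral_add(1)) (simp_all add: mult.commute)
  then show "?p absolutely_integrable_on {a..b}" for a b .
  have intp: "?p integrable_on {a..b}" for a b
    using absp absolutely_integrable_on_def by blast
  define M where "M s t = integral {s..t} (\<lambda>x. norm (w x) + norm (v x))" for s t
  have intM: "(\<lambda>x. norm (w x) + norm (v x)) integrable_on {s..t}" for s t
    using AC_derivD(1)[OF y] AC_derivD(1)[OF z]
    by (intro integrable_add) (auto simp: absolutely_integrable_on_def)
  define E where "E s t = y t * z t - y s * z s - integral {s..t} ?p" for s t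
  have E_add: "E r t = E r s + E s t" if "r \<le> s" "s \<le> t" for r s t
    using Henstock_Kurzweil_Integration.integral_combine[OF that intp, symmetric] by (simp add: E_def)
  have M_add: "M r t = M r s + M s t" if "r \<le> s" "s \<le> t" for r s t
    using Henstock_Kurzweil_Integration.integral_combine[OF that intM] by (simp add: M_def)
  have E_local: "norm (E s t) \<le> \<epsilon> * M s t"
    if "s \<le> t" and osc: "\<And>x. x \<in> {s..t} \<Longrightarrow> norm (y x - y s) \<le> \<epsilon>" "\<And>x. x \<in> {s..t} \<Longrightarrow> norm (z t - z x) \<le> \<epsilon>"
    for s t \<epsilon>
  proof -
    \<comment> \<open>With \<open>z\<close> frozen at the right end and \<open>y\<close> at the left
      end the product formula is exact, since the value equals \<open>y t * z t - y s * z s\<close>.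
      Hence \<open>E s t\<close> is the integral of the freezing errors alone.\<close>
    have "((\<lambda>x. w x * z t + y s * v x) has_integral ((y t - y s) * z t + y s * (z t - z s))) {s..t}"
      by (intro has_integral_add has_integral_mult_left has_integral_mult_right AC_derivD(3) y z that)
    from has_integral_diff[OF this integrable_integral[OF intp]]
    have "((\<lambda>x. w x * (z t - z x) - (y x - y s) * v x) has_integral E s t) {s..t}"
      by (simp add: E_def algebra_simps)
    then have int: "(\<lambda>x. w x * (z t - z x) - (y x - y s) * v x) integrable_on {s..t}"
      and E: "E s t = integral {s..t} (\<lambda>x. w x * (z t - z x) - (y x - y s) * v x)"
      by (auto simp: integrable_on_def integral_unique)
    have "norm (E s t) \<le> integral {s..t} (\<lambda>x. \<epsilon> * (norm (w x) + norm (v x)))"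
      unfolding E
    proof (rule integral_norm_bound_integral[OF int])
      show "(\<lambda>x. \<epsilon> * (norm (w x) + norm (v x))) integrable_on {s..t}"
        using intM by (rule integrable_on_mult_right)
      fix x assume x: "x \<in> {s..t}"
      have "norm (w x * (z t - z x) - (y x - y s) * v x) \<le> norm (w x) * norm (z t - z x) + norm (y x - y s) * norm (v x)"
        by (metis norm_mult norm_triangle_ineq4)
      also have "\<dots> \<le> norm (w x) * \<epsilon> + \<epsilon> * norm (v x)"
        using osc[OF x] by (intro add_mono mult_left_mono mult_right_mono) auto
      finally show "norm (w x * (z t - z x) - (y x - y s) * v x) \<le> \<epsilon> * (norm (w x) + norm (v x))"
        by (simp add: algebra_simps)
    qed
    then show ?thesis by (simp add: M_def)
  qed
  fix a b :: real assume "a \<le> b"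
  have small: "norm (E a b) \<le> \<epsilon> * M a b" if "\<epsilon> > 0" for \<epsilon>
  proof -
    have "uniformly_continuous_on {a..b} y" "uniformly_continuous_on {a..b} z"
      using y z by (auto intro!: compact_uniformly_continuous AC_deriv_continuous)
    with that obtain d1 d2 where d: "d1 > 0" "d2 > 0"
      and d1: "\<And>s t. \<lbrakk>s \<in> {a..b}; t \<in> {a..b}; dist t s < d1\<rbrakk> \<Longrightarrow> dist (y t) (y s) < \<epsilon>"
      and d2: "\<And>s t. \<lbrakk>s \<in> {a..b}; t \<in> {a..b}; dist t s < d2\<rbrakk> \<Longrightarrow> dist (z t) (z s) < \<epsilon>"
      unfolding uniformly_continuous_on_def by metis
    show ?thesis
    proof (rule interval_function_bound[where e = "\<lambda>s t. norm (E s t)" and m = "\<lambda>s t. \<epsilon> * M s t"])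
      \<comment> \<open>Halving turns the strict inequality of uniform continuity into one that
        admits length equal to the chosen bound.\<close>
      show "min d1 d2 / 2 > 0" using d by simp
      fix s t assume st: "a \<le> s" "s \<le> t" "t \<le> b" "t - s \<le> min d1 d2 / 2"
      show "norm (E s t) \<le> \<epsilon> * M s t"
      proof (rule E_local[OF \<open>s \<le> t\<close>])
        fix x assume x: "x \<in> {s..t}"
        show "norm (y x - y s) \<le> \<epsilon>"
          using d1[of s x] x st d by (auto simp: dist_norm)
        show "norm (z t - z x) \<le> \<epsilon>"
          using d2[of x t] x st d by (auto simp: dist_norm)
      qed
    next
      fix r s t assume "a \<le> r" "r \<le> s" "s \<le> t" "t \<le> b"
      then show "norm (E r t) \<le> norm (E r s) + norm (E s t)" "\<epsilon> * M r s + \<epsilon> * M s t \<le> \<epsilon> * M r t"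
        by (simp_all add: E_add[of r s t] M_add[of r s t] norm_triangle_ineq algebra_simps)
    qed fact
  qed
  have "M a b \<ge> 0"
    unfolding M_def using intM by (intro integral_nonneg) auto
  have "norm (E a b) \<le> \<epsilon>" if "\<epsilon> > 0" for \<epsilon>
  proof -
    \<comment> \<open>The summand 1 in the denominator covers the case
      \<open>M a b = 0\<close>.\<close>
    have "norm (E a b) \<le> \<epsilon> / (M a b + 1) * M a b"
      using that \<open>M a b \<ge> 0\<close> by (intro small) auto
    also have "\<dots> \<le> \<epsilon>"
      using that \<open>M a b \<ge> 0\<close> by (simp add: field_simps)
    finally show ?thesis .
  qed
  then have "norm (E a b) \<le> 0"
    using field_le_epsilon[of "norm (E a b)" 0] by simp
  then have "integral {a..b} ?p = y b * z b - y a * z a"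
    by (simp add: E_def)
  then show "(?p has_integral (y b * z b - y a * z a)) {a..b}"
    using integrable_integral[OF intp] by metis
qed

text \<open>The boundary terms vanish. Every integration by parts below takes this form, with a
  cutoff or a compactly supported test function as a factor.\<close>

lemma AC_deriv_compact_support:
  assumes "AC_deriv y w" "\<And>x. r \<le> \<bar>x\<bar> \<Longrightarrow> y x = 0" "\<And>x. r \<le> \<bar>x\<bar> \<Longrightarrow> w x = 0"
  shows "integrable lebesgue w" "integral\<^sup>L lebesgue w = 0"
proof -
  have "w absolutely_integrable_on {-r..r}" "(\<lambda>x. indicator {-r..r} x *\<^sub>R w x) = w"
    using AC_derivD(1)[OF assms(1)] assms(3) by (auto simp: fun_eq_iff indicator_def)
  then show int: "integrable lebesgue w"
    by (simp add: set_integrable_def)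
  \<comment> \<open>The sign of \<open>r\<close> is arbitrary; with \<open>max r 0\<close> the
    interval is nonempty and \<open>y\<close> still vanishes at both ends.\<close>
  have "(w has_integral (y (max r 0) - y (- max r 0))) {- max r 0..max r 0}"
    by (rule AC_derivD(3)[OF assms(1)]) auto
  then have "(w has_integral 0) {- max r 0..max r 0}"
    using assms(2) by auto
  then have "(w has_integral 0) UNIV"
    using assms(3) by (rule has_integral_on_superset) auto
  moreover have "(w has_integral (integral\<^sup>L lebesgue w)) UNIV"
    using int by (rule has_integral_integral_lebesgue)
  ultimately show "integral\<^sup>L lebesgue w = 0"
    using has_integral_unique by blast
qed

section \<open>Cutoff functions and square integrable functions\<close>

text \<open>A truncated parabola: it is absolutely continuous, its slope is at most
  \<open>2 / r\<close>, and it tends to 1 pointwise as \<open>r\<close> grows.\<close>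

definition cutoff :: "real \<Rightarrow> real \<Rightarrow> real" where
  "cutoff r x = max 0 (1 - (x / r)\<^sup>2)"

text \<open>At the corners \<open>r\<close> and \<open>- r\<close> the value is set to 0, so that it
  vanishes wherever \<open>r\<close> is at most the modulus of \<open>x\<close>, as
  \<open>AC_deriv_compact_support\<close> requires.\<close>

definition cutoff_deriv :: "real \<Rightarrow> real \<Rightarrow> real" where
  "cutoff_deriv r x = (if \<bar>x\<bar> < r then - 2 * x / r\<^sup>2 else 0)"

lemma cutoff_bounds: "0 \<le> cutoff r x" "cutoff r x \<le> 1"
  by (auto simp: cutoff_def)

lemma cutoff_eq_0:
  assumes "0 < r" "r \<le> \<bar>x\<bar>"
  shows "cutoff r x = 0" "cutoff_deriv r x = 0"
proof -
  have "1\<^sup>2 \<le> \<bar>x / r\<bar>\<^sup>2"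
    using assms by (intro power_mono) auto
  then have "1 \<le> (x / r)\<^sup>2"
    by (simp only: power2_abs one_power2)
  then show "cutoff r x = 0"
    by (simp add: cutoff_def)
qed (use assms in \<open>auto simp: cutoff_deriv_def\<close>)

lemma cutoff_deriv_bound:
  assumes "1 \<le> r"
  shows "\<bar>cutoff_deriv r x\<bar> \<le> 2 / r" "\<bar>cutoff_deriv r x\<bar> \<le> 2"
proof -
  show *: "\<bar>cutoff_deriv r x\<bar> \<le> 2 / r"
    using assms by (auto simp: cutoff_deriv_def abs_mult field_simps power2_eq_square)
  moreover have "2 / r \<le> 2" using assms by (simp add: field_simps)
  ultimately show "\<bar>cutoff_deriv r x\<bar> \<le> 2" by linarith
qed

lemma cutoff_tendsto: "(\<lambda>n. cutoff (real (Suc n)) x) \<longlonglongrightarrow> 1"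
proof -
  have "(\<lambda>n. x / real (Suc n)) \<longlonglongrightarrow> 0"
    by (rule LIMSEQ_Suc[OF tendsto_divide_0[OF tendsto_const filterlim_real_at_infinity_sequentially]])
  then have "(\<lambda>n. max 0 (1 - (x / real (Suc n))\<^sup>2)) \<longlonglongrightarrow> max 0 (1 - 0\<^sup>2)"
    by (intro tendsto_intros)
  then show ?thesis by (simp add: cutoff_def)
qed

lemma cutoff_deriv_tendsto: "(\<lambda>n. cutoff_deriv (real (Suc n)) x) \<longlonglongrightarrow> 0"
proof (rule Lim_null_comparison)
  show "\<forall>\<^sub>F n in sequentially. norm (cutoff_deriv (real (Suc n)) x) \<le> 2 / real (Suc n)"
    using cutoff_deriv_bound(1) by (intro always_eventually) auto
  show "(\<lambda>n. 2 / real (Suc n)) \<longlonglongrightarrow> 0"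
    by (rule LIMSEQ_Suc[OF tendsto_divide_0[OF tendsto_const filterlim_real_at_infinity_sequentially]])
qed

lemma AC_deriv_cutoff:
  assumes "1 \<le> r"
  shows "AC_deriv (\<lambda>x. of_real (cutoff r x)) (\<lambda>x. of_real (cutoff_deriv r x))"
proof (rule AC_derivI)
  have der: "(cutoff r has_vector_derivative cutoff_deriv r x) (at x)" if "x \<notin> {r, -r}" for x
  proof (cases "\<bar>x\<bar> < r")
    case True
    have 1: "((\<lambda>x. 1 - (x / r)\<^sup>2) has_vector_derivative - 2 * x / r\<^sup>2) (at x)"
      unfolding has_real_derivative_iff_has_vector_derivative[symmetric]
      using assms by (auto intro!: derivative_eq_intros simp: power2_eq_square field_simps)
    have "1 - (t / r)\<^sup>2 = cutoff r t" if "t \<in> {-r<..<r}" for t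
    proof -
      have "\<bar>t / r\<bar>\<^sup>2 \<le> 1"
        using that assms by (intro power_le_one) auto
      then have "(t / r)\<^sup>2 \<le> 1"
        by (simp only: power2_abs)
      then show ?thesis by (simp add: cutoff_def)
    qed
    then have "(cutoff r has_vector_derivative - 2 * x / r\<^sup>2) (at x)"
      using True by (intro has_vector_derivative_transform_within_open[OF 1, of "{-r<..<r}"]) auto
    then show ?thesis
      using True by (simp add: cutoff_deriv_def)
  next
    case False
    then have "x \<in> - {-r..r}"
      using that by auto
    moreover have "((\<lambda>x. 0) has_vector_derivative cutoff_deriv r x) (at x)"
      using False by (auto simp: cutoff_deriv_def)
    moreover have "0 = cutoff r t" if "t \<in> - {-r..r}" for t
      using that assms cutoff_eq_0[of r t] by auto
    ultimately show ?thesis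
      by (metis closed_atLeastAtMost has_vector_derivative_transform_within_open open_Compl)
  qed
  have cont: "continuous_on S (cutoff r)" for S
    unfolding cutoff_def using assms by (intro continuous_intros) auto
  have int: "(cutoff_deriv r has_integral (cutoff r b - cutoff r a)) {a..b}" if "a \<le> b" for a b
    \<comment> \<open>The two corners form the finite exceptional set of the fundamental
      theorem.\<close>
    using that der cont by (intro fundamental_theorem_of_calculus_interior_strong[of "{r, -r}"]) auto
  then show "((\<lambda>x. complex_of_real (cutoff_deriv r x)) has_integral of_real (cutoff r b) - of_real (cutoff r a)) {a..b}"
    if "a \<le> b" for a b
    using has_integral_of_real[OF int[OF that], where ?'b = complex] by simp
  fix a b :: real
  have "cutoff_deriv r absolutely_integrable_on {a..b}"
  proof (rule absolutely_integrable_integrable_bound)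
    show "norm (cutoff_deriv r x) \<le> 2" for x
      using cutoff_deriv_bound(2)[OF assms] by simp
    show "cutoff_deriv r integrable_on {a..b}"
      using int[of a b] by (cases "a \<le> b") (auto simp: integrable_on_def)
  qed (rule integrable_const_ivl)
  from absolutely_integrable_linear[OF this bounded_linear_of_real]
  show "(\<lambda>x. complex_of_real (cutoff_deriv r x)) absolutely_integrable_on {a..b}"
    by (simp add: o_def)
qed

lemma L2_cong_AE:
  assumes "L2 f" "AE x in lebesgue. f x = g x"
  shows "L2 g"
proof -
  have m: "f \<in> borel_measurable lebesgue" and g: "g \<in> borel_measurable lebesgue"
    using assms borel_measurable_AE by (auto simp: L2_def)
  have "integrable lebesgue (\<lambda>x. (cmod (f x))\<^sup>2) \<longleftrightarrow> integrable lebesgue (\<lambda>x. (cmod (g x))\<^sup>2)"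
    using assms m g by (intro integrable_cong_AE) auto
  then show ?thesis
    using assms(1) g by (simp add: L2_def)
qed

lemma L2_measurable: "L2 f \<Longrightarrow> f \<in> borel_measurable lebesgue"
  by (simp add: L2_def)

lemma L2_square_integrable: "L2 f \<Longrightarrow> integrable lebesgue (\<lambda>x. (cmod (f x))\<^sup>2)"
  by (simp add: L2_def)

lemma L2_bound:
  assumes "f \<in> borel_measurable lebesgue" "integrable lebesgue G" "\<And>x. (cmod (f x))\<^sup>2 \<le> G x"
  shows "L2 f"
  unfolding L2_def
proof
  show "integrable lebesgue (\<lambda>x. (cmod (f x))\<^sup>2)"
    using assms by (intro Bochner_Integration.integrable_bound[OF assms(2)]) (auto intro: order_trans[OF _ abs_ge_self])
qed fact

lemma L2_add:
  assumes "L2 f" "L2 g"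
  shows "L2 (\<lambda>x. f x + g x)"
proof (rule L2_bound)
  show "(\<lambda>x. f x + g x) \<in> borel_measurable lebesgue"
    using assms by (auto simp: L2_def)
  show "integrable lebesgue (\<lambda>x. 2 * (cmod (f x))\<^sup>2 + 2 * (cmod (g x))\<^sup>2)"
    using assms by (auto simp: L2_def)
  fix x
  have "(cmod (f x + g x))\<^sup>2 \<le> (cmod (f x) + cmod (g x))\<^sup>2"
    by (intro power_mono norm_triangle_ineq) auto
  then show "(cmod (f x + g x))\<^sup>2 \<le> 2 * (cmod (f x))\<^sup>2 + 2 * (cmod (g x))\<^sup>2"
    using sum_squares_bound[of "cmod (f x)" "cmod (g x)"] by (simp add: power2_sum)
qed

lemma L2_uminus: "L2 f \<Longrightarrow> L2 (\<lambda>x. - f x)"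
  by (auto simp: L2_def)

lemma L2_diff: "L2 f \<Longrightarrow> L2 g \<Longrightarrow> L2 (\<lambda>x. f x - g x)"
  using L2_add[OF _ L2_uminus] by simp

lemma L2_cnj:
  assumes "L2 f"
  shows "L2 (\<lambda>x. cnj (f x))"
proof -
  have "cnj \<in> borel_measurable borel"
    by (intro borel_measurable_continuous_onI continuous_intros)
  from measurable_compose[OF L2_measurable[OF assms] this] show ?thesis
    using assms by (simp add: L2_def)
qed

lemma L2_mult_integrable:
  assumes "L2 f" "L2 g"
  shows "integrable lebesgue (\<lambda>x. f x * g x)"
proof (rule Bochner_Integration.integrable_bound)
  show "integrable lebesgue (\<lambda>x. (cmod (f x))\<^sup>2 + (cmod (g x))\<^sup>2)"
    using assms by (auto simp: L2_def)
  show "(\<lambda>x. f x * g x) \<in> borel_measurable lebesgue"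
    using assms by (auto simp: L2_def)
  have "cmod (f x * g x) \<le> (cmod (f x))\<^sup>2 + (cmod (g x))\<^sup>2" for x
    using sum_squares_bound[of "cmod (f x)" "cmod (g x)"]
      mult_nonneg_nonneg[OF norm_ge_zero norm_ge_zero, of "f x" "g x"]
    unfolding norm_mult by linarith
  then show "AE x in lebesgue. norm (f x * g x) \<le> norm ((cmod (f x))\<^sup>2 + (cmod (g x))\<^sup>2)"
    by (intro AE_I2) (auto intro: order_trans)
qed

text \<open>Fatou's lemma along \<open>r\<close> = 1, 2, 3, and so on. Only the integral of the
  majorant \<open>G\<close> is bounded uniformly in \<open>r\<close>; \<open>G\<close> itself may
  vary, so it may contain derivatives of compactly supported functions, whose integrals
  vanish.\<close>

lemma L2_from_cutoffs:
  assumes f[measurable]: "f \<in> borel_measurable lebesgue"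
    and G: "\<And>r. 1 \<le> r \<Longrightarrow> \<exists>G. integrable lebesgue G \<and> integral\<^sup>L lebesgue G \<le> C \<and>
              (AE x in lebesgue. (cutoff r x * cmod (f x))\<^sup>2 \<le> G x)"
  shows "L2 f"
proof -
  let ?h = "\<lambda>n x. ennreal ((cutoff (real (Suc n)) x * cmod (f x))\<^sup>2)"
  have cm[measurable]: "cutoff r \<in> borel_measurable lebesgue" for r
    unfolding cutoff_def by (intro measurable_completion) measurable
  have le: "(\<integral>\<^sup>+x. ?h n x \<partial>lebesgue) \<le> ennreal C" for n
  proof -
    obtain G where G: "integrable lebesgue G" "integral\<^sup>L lebesgue G \<le> C"
      "AE x in lebesgue. (cutoff (real (Suc n)) x * cmod (f x))\<^sup>2 \<le> G x"
      using G[of "real (Suc n)"] by auto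
    have "AE x in lebesgue. 0 \<le> G x"
      using G(3) by eventually_elim (meson order_trans zero_le_power2)
    have "(\<integral>\<^sup>+x. ?h n x \<partial>lebesgue) \<le> (\<integral>\<^sup>+x. ennreal (G x) \<partial>lebesgue)"
      using G(3) by (intro nn_integral_mono_AE) (auto elim!: eventually_mono intro: ennreal_leI)
    also have "\<dots> = ennreal (integral\<^sup>L lebesgue G)"
      by (rule nn_integral_eq_integral) fact+
    also have "\<dots> \<le> ennreal C"
      using G(2) by (rule ennreal_leI)
    finally show ?thesis .
  qed
  have lim: "liminf (\<lambda>n. ?h n x) = ennreal ((cmod (f x))\<^sup>2)" for x
  proof -
    have "(\<lambda>n. ?h n x) \<longlonglongrightarrow> ennreal ((1 * cmod (f x))\<^sup>2)"
      by (intro tendsto_intros cutoff_tendsto tendsto_ennrealI)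
    then show ?thesis
      by (simp add: lim_imp_Liminf)
  qed
  have "(\<integral>\<^sup>+x. ennreal ((cmod (f x))\<^sup>2) \<partial>lebesgue) = (\<integral>\<^sup>+x. liminf (\<lambda>n. ?h n x) \<partial>lebesgue)"
    by (simp only: lim)
  also have "\<dots> \<le> liminf (\<lambda>n. \<integral>\<^sup>+x. ?h n x \<partial>lebesgue)"
    by (rule nn_integral_liminf) measurable
  also have "\<dots> \<le> ennreal C"
    using le by (intro Liminf_le) auto
  finally have "(\<integral>\<^sup>+x. ennreal ((cmod (f x))\<^sup>2) \<partial>lebesgue) < \<infinity>"
    by (simp add: le_less_trans)
  then show ?thesis
    unfolding L2_def by (auto intro!: integrableI_bounded)
qed

section \<open>Form boundedness of a periodic potential\<close>

locale periodic_potential =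
  fixes Q :: "real \<Rightarrow> real"
  assumes periodic: "Q (x + 1) = Q x"
    and measurable: "Q \<in> borel_measurable lebesgue"
    and square_integrable: "(\<lambda>x. (Q x)\<^sup>2) integrable_on {0..1}"
begin

text \<open>Translation by one period carries integrability from \<open>{0..1}\<close> to all unit
  intervals, which are then glued together.\<close>

lemma square_integrable_Icc: "(\<lambda>x. (Q x)\<^sup>2) absolutely_integrable_on {a..b}"
proof -
  have shift: "(\<lambda>x. (Q x)\<^sup>2) integrable_on {c-1..d-1}" if "(\<lambda>x. (Q x)\<^sup>2) integrable_on {c..d}" for c d
    using integrable_shift_real_ivl[OF that, of 1] by (simp add: periodic)
  have shift': "(\<lambda>x. (Q x)\<^sup>2) integrable_on {c+1..d+1}" if "(\<lambda>x. (Q x)\<^sup>2) integrable_on {c..d}" for c d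
    using integrable_shift_real_ivl[OF that, of "-1"] periodic[of "_ - 1"] by simp
  \<comment> \<open>Counting starts at \<open>{-1..0}\<close>: the induction below shifts
    \<open>{- n..n}\<close> to the left and then bridges \<open>{n - 1..n}\<close>, already for
    \<open>n\<close> = 0.\<close>
  have unit: "(\<lambda>x. (Q x)\<^sup>2) integrable_on {real m - 1..real m}" for m
  proof (induction m)
    case 0
    then show ?case using shift[OF square_integrable] by simp
  next
    case (Suc m)
    then show ?case using shift'[OF Suc] by (simp add: add.commute)
  qed
  have *: "(\<lambda>x. (Q x)\<^sup>2) integrable_on {- real n..real n}" for n
  proof (induction n)
    case 0
    then show ?case using integrable_on_refl[of _ 0] by auto
  next
    case (Suc n)
    have "(\<lambda>x. (Q x)\<^sup>2) integrable_on {- real (Suc n)..real n - 1}"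
    proof -
      have "- real (Suc n) = - real n - 1" by simp
      then show ?thesis using shift[OF Suc] by (simp only:)
    qed
    moreover note unit[of n]
    ultimately have "(\<lambda>x. (Q x)\<^sup>2) integrable_on {- real (Suc n)..real n}"
      by (rule Henstock_Kurzweil_Integration.integrable_combine[rotated 2]) auto
    moreover have "(\<lambda>x. (Q x)\<^sup>2) integrable_on {real n..real (Suc n)}"
      using unit[of "Suc n"] by simp
    ultimately show ?case
      by (rule Henstock_Kurzweil_Integration.integrable_combine[rotated 2]) auto
  qed
  obtain n where "max \<bar>a\<bar> \<bar>b\<bar> \<le> real n"
    using real_arch_simple by blast
  with * have "(\<lambda>x. (Q x)\<^sup>2) integrable_on {a..b}"
    by (intro integrable_on_subinterval[OF *[of n]]) auto
  then show ?thesis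
    by (rule nonnegative_absolutely_integrable_1) auto
qed

text \<open>Subtracting the mean \<open>K\<close> over a period makes the increment of the primitive
  over a period vanish, so \<open>P\<close> is periodic and bounded by its maximum on
  \<open>{0..1}\<close>.\<close>

lemma bounded_primitive:
  obtains K B P where "0 \<le> K" "0 \<le> B" "AC_deriv P (\<lambda>x. of_real ((Q x)\<^sup>2 - K))" "\<And>x. cmod (P x) \<le> B"
proof -
  define K where "K = integral {0..1} (\<lambda>x. (Q x)\<^sup>2)"
  define g where "g x = complex_of_real ((Q x)\<^sup>2 - K)" for x
  have "(\<lambda>x. (Q x)\<^sup>2 - K) absolutely_integrable_on {a..b}" for a b
    by (intro set_integral_diff(1) square_integrable_Icc absolutely_integrable_on_const) simp
  from absolutely_integrable_linear[OF this bounded_linear_of_real[where 'a = complex]]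
  have "g absolutely_integrable_on {a..b}" for a b
    by (simp add: o_def g_def[abs_def])
  then obtain P where P: "AC_deriv P g" and P0: "P 0 = 0"
    using AC_deriv_exists by blast
  \<comment> \<open>The periodicity of \<open>P'\<close> passes to the increments of
    \<open>P\<close>; with \<open>P 0 = P 1\<close> this gives the periodicity of
    \<open>P\<close>.\<close>
  have incr: "P (b + 1) - P (a + 1) = P b - P a" if "a \<le> b" for a b
  proof -
    have "g (x + 1) = g x" for x by (simp add: g_def periodic)
    then have "(g has_integral (P (b + 1) - P (a + 1))) {a..b}"
      using has_integral_shift_real_ivl[OF AC_derivD(3)[OF P, of "a + 1" "b + 1"], of 1] that by simp
    then show ?thesis
      using AC_derivD(3)[OF P that] has_integral_unique by blast
  qed
  have "((\<lambda>x. (Q x)\<^sup>2) has_integral K) {0..1}"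
    unfolding K_def using square_integrable by (rule integrable_integral)
  from has_integral_diff[OF this has_integral_const_real[of K 0 1]]
  have "((\<lambda>x. (Q x)\<^sup>2 - K) has_integral 0) {0..1}"
    by simp
  from has_integral_of_real[OF this, where ?'b = complex]
  have "(g has_integral 0) {0..1}"
    by (simp add: g_def[abs_def])
  from has_integral_unique[OF AC_derivD(3)[OF P, of 0 1] this] have P1: "P 1 = 0"
    using P0 by simp
  have per: "P (x + 1) = P x" for x
  proof (cases "0 \<le> x")
    case True
    then show ?thesis using incr[of 0 x] P0 P1 by simp
  next
    case False
    then have "P (0 + 1) - P (x + 1) = P 0 - P x" by (intro incr) simp
    then show ?thesis using P0 P1 by simp
  qed
  have per_int: "P (x + real n) = P x" "P (x - real n) = P x" for x n
  proof -
    show "P (x + real n) = P x"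
    proof (induction n)
      case (Suc n)
      then show ?case using per[of "x + real n"] by (simp add: algebra_simps)
    qed simp
    show "P (x - real n) = P x"
    proof (induction n)
      case (Suc n)
      then show ?case using per[of "x - real (Suc n)"] by (simp add: algebra_simps)
    qed simp
  qed
  have P_frac: "P x = P (frac x)" for x
  proof (cases "0 \<le> \<lfloor>x\<rfloor>")
    case True
    then show ?thesis
      using per_int(1)[of "frac x" "nat \<lfloor>x\<rfloor>"] by (simp add: frac_def)
  next
    case False
    then show ?thesis
      using per_int(2)[of "frac x" "nat (- \<lfloor>x\<rfloor>)"] by (simp add: frac_def)
  qed
  have "bounded (P ` {0..1})"
    using AC_deriv_continuous[OF P] by (intro compact_imp_bounded compact_continuous_image) auto
  then obtain B where B: "B > 0" "\<And>x. x \<in> {0..1} \<Longrightarrow> cmod (P x) \<le> B"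
    unfolding bounded_pos by auto
  have "cmod (P x) \<le> B" for x
    unfolding P_frac[of x] using frac_lt_1[of x] by (intro B(2)) (simp add: less_imp_le)
  moreover have "0 \<le> K"
    unfolding K_def using square_integrable by (intro integral_nonneg) auto
  ultimately show ?thesis
    using that[of K B P] P \<open>B > 0\<close> by (auto simp: g_def[abs_def])
qed

text \<open>Integrating the derivative of the compactly supported function \<open>P \<bar>\<phi>y\<bar>\<^sup>2\<close>, where \<open>P' = Q\<^sup>2 - K\<close>
  with bounded \<open>P\<close>, trades \<open>Q\<^sup>2\<close> for first-order terms.\<close>

lemma potential_estimate:
  obtains K B where "0 \<le> K" "0 \<le> B"
    "\<And>y w r. \<lbrakk>AC_deriv y w; 1 \<le> r\<rbrakk> \<Longrightarrow> \<exists>p. integrable lebesgue p \<and> integral\<^sup>L lebesgue p = 0 \<and>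
       (\<forall>x. (cutoff r x * (\<bar>Q x\<bar> * cmod (y x)))\<^sup>2 \<le>
          p x + K * (cmod (y x))\<^sup>2 + 2 * B * cmod (y x) * (cutoff r x * cmod (w x) + 2 * cmod (y x)))"
proof -
  obtain K B P where K: "0 \<le> K" "0 \<le> B" and P: "AC_deriv P (\<lambda>x. of_real ((Q x)\<^sup>2 - K))"
    and PB: "\<And>x. cmod (P x) \<le> B"
    using bounded_primitive by blast
  show ?thesis
  proof (rule that[OF K])
    fix y w r assume y: "AC_deriv y w" and r: "1 \<le> (r::real)"
    define m where "m x = of_real (cutoff r x) * y x" for x
    define m' where "m' x = of_real (cutoff_deriv r x) * y x + of_real (cutoff r x) * w x" for x
    have m: "AC_deriv m m'"
      using AC_deriv_mult[OF AC_deriv_cutoff[OF r] y] by (simp add: m_def[abs_def] m'_def[abs_def])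
    let ?p = "\<lambda>x. of_real ((Q x)\<^sup>2 - K) * (m x * cnj (m x)) + P x * (m' x * cnj (m x) + m x * cnj (m' x))"
    have AC: "AC_deriv (\<lambda>x. P x * (m x * cnj (m x))) ?p"
      by (intro AC_deriv_mult P m AC_deriv_cnj)
    have "m x = 0" "m' x = 0" if "r \<le> \<bar>x\<bar>" for x
      using cutoff_eq_0[OF _ that] r by (auto simp: m_def m'_def)
    then have p: "integrable lebesgue ?p" "integral\<^sup>L lebesgue ?p = 0"
      by (intro AC_deriv_compact_support[OF AC, of r]; simp)+
    \<comment> \<open>The estimate is kept pointwise, with a summand of integral zero, so that it
      can be combined with other inequalities before integrating. The 2 in front of \<open>B\<close>
      counts two conjugate terms; the 2 in front of the last \<open>cmod (y x)\<close> bounds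
      \<open>cutoff_deriv\<close>.\<close>
    have "(cutoff r x * (\<bar>Q x\<bar> * cmod (y x)))\<^sup>2 \<le>
        Re (?p x) + K * (cmod (y x))\<^sup>2 + 2 * B * cmod (y x) * (cutoff r x * cmod (w x) + 2 * cmod (y x))" for x
    proof -
      have mm: "m x * cnj (m x) = of_real ((cmod (m x))\<^sup>2)"
        by (simp only: complex_norm_square)
      have my: "cmod (m x) = cutoff r x * cmod (y x)"
        using cutoff_bounds by (simp add: m_def norm_mult)
      then have le: "cmod (m x) \<le> cmod (y x)"
        using cutoff_bounds by (simp add: mult_left_le_one_le)
      have "cmod (m' x) \<le> \<bar>cutoff_deriv r x\<bar> * cmod (y x) + cutoff r x * cmod (w x)"
        unfolding m'_def by (rule order_trans[OF norm_triangle_ineq]) (simp add: norm_mult cutoff_bounds)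
      also have "\<dots> \<le> 2 * cmod (y x) + cutoff r x * cmod (w x)"
        using cutoff_deriv_bound(2)[OF r] by (intro add_mono mult_right_mono) auto
      finally have m'y: "cmod (m' x) \<le> cutoff r x * cmod (w x) + 2 * cmod (y x)" by simp
      have "- Re (P x * (m' x * cnj (m x) + m x * cnj (m' x))) \<le> cmod (P x * (m' x * cnj (m x) + m x * cnj (m' x)))"
        using abs_Re_le_cmod by (metis abs_le_D2)
      also have "\<dots> \<le> cmod (P x) * (cmod (m' x * cnj (m x)) + cmod (m x * cnj (m' x)))"
        by (metis norm_mult norm_triangle_ineq mult_left_mono norm_ge_zero)
      also have "\<dots> \<le> B * (2 * (cmod (y x) * (cutoff r x * cmod (w x) + 2 * cmod (y x))))"
      proof (intro mult_mono PB)
        have "cmod (m x) * cmod (m' x) \<le> cmod (y x) * (cutoff r x * cmod (w x) + 2 * cmod (y x))"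
          using le m'y by (intro mult_mono) auto
        then show "cmod (m' x * cnj (m x)) + cmod (m x * cnj (m' x)) \<le> 2 * (cmod (y x) * (cutoff r x * cmod (w x) + 2 * cmod (y x)))"
          by (simp add: norm_mult mult.commute)
      qed (use K in auto)
      moreover have "K * (cmod (m x))\<^sup>2 \<le> K * (cmod (y x))\<^sup>2"
        using le K by (intro mult_left_mono power_mono) auto
      moreover have "Re (of_real ((Q x)\<^sup>2 - K) * (m x * cnj (m x))) = (cutoff r x * (\<bar>Q x\<bar> * cmod (y x)))\<^sup>2 - K * (cmod (m x))\<^sup>2"
        unfolding mm my by (simp add: power_mult_distrib algebra_simps)
      ultimately show ?thesis
        by simp
    qed
    moreover have "integrable lebesgue (\<lambda>x. Re (?p x))" "integral\<^sup>L lebesgue (\<lambda>x. Re (?p x)) = 0"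
      using integrable_Re[OF p(1)] integral_Re[OF p(1)] p(2) by (simp_all only: complex.sel zero_complex.sel)
    ultimately show "\<exists>p. integrable lebesgue p \<and> integral\<^sup>L lebesgue p = 0 \<and>
       (\<forall>x. (cutoff r x * (\<bar>Q x\<bar> * cmod (y x)))\<^sup>2 \<le>
          p x + K * (cmod (y x))\<^sup>2 + 2 * B * cmod (y x) * (cutoff r x * cmod (w x) + 2 * cmod (y x)))"
      by blast
  qed
qed

text \<open>When \<open>u'\<close> is square integrable, the right side of the potential estimate is
  dominated, up to a term of integral zero, by a function \<open>H\<close> independent of the
  cutoff.\<close>

lemma L2_potential_mult:
  assumes "H1_deriv u u'"
  shows "L2 (\<lambda>x. of_real (Q x) * u x)"
proof -
  obtain y where y: "AC_deriv y u'" and uy: "AE x in lebesgue. u x = y x" and L2: "L2 u" "L2 u'"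
    using assms by (auto simp: H1_deriv_def)
  have L2y: "L2 y" using L2_cong_AE[OF L2(1) uy] .
  obtain K B where KB: "0 \<le> K" "0 \<le> B" and est:
    "\<And>y w r. \<lbrakk>AC_deriv y w; 1 \<le> r\<rbrakk> \<Longrightarrow> \<exists>p. integrable lebesgue p \<and> integral\<^sup>L lebesgue p = 0 \<and>
       (\<forall>x. (cutoff r x * (\<bar>Q x\<bar> * cmod (y x)))\<^sup>2 \<le>
          p x + K * (cmod (y x))\<^sup>2 + 2 * B * cmod (y x) * (cutoff r x * cmod (w x) + 2 * cmod (y x)))"
    using potential_estimate by blast
  \<comment> \<open>Of the 5 in \<open>5 * B\<close>, 4 comes from the cutoff derivative and 1 from
    splitting \<open>2 * cmod (y x) * cmod (u' x)\<close> into squares, which also yields the last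
    term.\<close>
  define H where "H x = (K + 5 * B) * (cmod (y x))\<^sup>2 + B * (cmod (u' x))\<^sup>2" for x
  have H: "integrable lebesgue H"
    unfolding H_def using L2y L2 by (intro Bochner_Integration.integrable_add integrable_mult_right L2_square_integrable)
  have "L2 (\<lambda>x. of_real (Q x) * y x)"
  proof (rule L2_from_cutoffs)
    show "(\<lambda>x. of_real (Q x) * y x) \<in> borel_measurable lebesgue"
      using measurable L2_measurable[OF L2y] by measurable
    fix r :: real assume r: "1 \<le> r"
    obtain p where p: "integrable lebesgue p" "integral\<^sup>L lebesgue p = 0"
      "\<And>x. (cutoff r x * (\<bar>Q x\<bar> * cmod (y x)))\<^sup>2 \<le>
          p x + K * (cmod (y x))\<^sup>2 + 2 * B * cmod (y x) * (cutoff r x * cmod (u' x) + 2 * cmod (y x))"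
      using est[OF y r] by blast
    have "(cutoff r x * cmod (of_real (Q x) * y x))\<^sup>2 \<le> p x + H x" for x
    proof -
      have "2 * cmod (y x) * (cutoff r x * cmod (u' x) + 2 * cmod (y x)) \<le> 2 * cmod (y x) * (cmod (u' x) + 2 * cmod (y x))"
        using cutoff_bounds by (intro mult_left_mono add_right_mono mult_left_le_one_le) auto
      also have "\<dots> \<le> 5 * (cmod (y x))\<^sup>2 + (cmod (u' x))\<^sup>2"
        using sum_squares_bound[of "cmod (y x)" "cmod (u' x)"] by (simp add: algebra_simps power2_eq_square)
      finally have "B * (2 * cmod (y x) * (cutoff r x * cmod (u' x) + 2 * cmod (y x))) \<le> B * (5 * (cmod (y x))\<^sup>2 + (cmod (u' x))\<^sup>2)"
        using KB by (intro mult_left_mono)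
      then show ?thesis
        using p(3)[of x] by (simp add: H_def norm_mult algebra_simps)
    qed
    then show "\<exists>G. integrable lebesgue G \<and> integral\<^sup>L lebesgue G \<le> integral\<^sup>L lebesgue H \<and>
        (AE x in lebesgue. (cutoff r x * cmod (of_real (Q x) * y x))\<^sup>2 \<le> G x)"
      using p H by (intro exI[of _ "\<lambda>x. p x + H x"]) auto
  qed
  then show ?thesis
    by (rule L2_cong_AE) (use uy in \<open>auto elim!: eventually_mono\<close>)
qed

section \<open>Comparison of the two operators\<close>

text \<open>Test the equation against \<open>\<phi>\<^sup>2 y\<close> and absorb the terms containing \<open>Q\<close> by the potential estimate.\<close>

lemma Smax_derivative_L2:
  assumes y0: "AC_deriv y0 w0" and y1: "AC_deriv y1 w1"
    and L2: "L2 y0" "L2 f"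
    and eq1: "AE x in lebesgue. y1 x = w0 x - of_real (Q x) * y0 x"
    and eq2: "AE x in lebesgue. f x = - w1 x - of_real (Q x) * y1 x - (of_real (Q x))\<^sup>2 * y0 x"
  shows "L2 w0"
proof -
  obtain K B where KB: "0 \<le> K" "0 \<le> B" and est:
    "\<And>y w r. \<lbrakk>AC_deriv y w; 1 \<le> r\<rbrakk> \<Longrightarrow> \<exists>p. integrable lebesgue p \<and> integral\<^sup>L lebesgue p = 0 \<and>
       (\<forall>x. (cutoff r x * (\<bar>Q x\<bar> * cmod (y x)))\<^sup>2 \<le>
          p x + K * (cmod (y x))\<^sup>2 + 2 * B * cmod (y x) * (cutoff r x * cmod (w x) + 2 * cmod (y x)))"
    using potential_estimate by blast
  \<comment> \<open>The coefficient of \<open>s\<^sup>2\<close> gathered below: 73/4 = 1/4 + 16 + 2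
    from completing squares, \<open>6 * K + 24 * B\<close> from six times the potential estimate,
    and \<open>144 * B\<^sup>2\<close> from absorbing its mixed term
    \<open>12 * B * s * a\<close>.\<close>
  define C where "C = 73 / 4 + 6 * K + 24 * B + 144 * B\<^sup>2"
  define H where "H x = 4 * (C * (cmod (y0 x))\<^sup>2 + (cmod (f x))\<^sup>2)" for x
  have H: "integrable lebesgue H"
    unfolding H_def using L2 by (intro integrable_mult_right Bochner_Integration.integrable_add L2_square_integrable)
  show ?thesis
  proof (rule L2_from_cutoffs)
    have "(\<lambda>x. y1 x + of_real (Q x) * y0 x) \<in> borel_measurable lebesgue"
      using measurable AC_deriv_measurable[OF y0] AC_deriv_measurable[OF y1] by measurable
    then show "w0 \<in> borel_measurable lebesgue"
      by (rule borel_measurable_AE) (use eq1 in \<open>auto elim!: eventually_mono\<close>)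
    fix r :: real assume r: "1 \<le> r"
    obtain p2 where p2: "integrable lebesgue p2" "integral\<^sup>L lebesgue p2 = 0"
      "\<And>x. (cutoff r x * (\<bar>Q x\<bar> * cmod (y0 x)))\<^sup>2 \<le>
          p2 x + K * (cmod (y0 x))\<^sup>2 + 2 * B * cmod (y0 x) * (cutoff r x * cmod (w0 x) + 2 * cmod (y0 x))"
      using est[OF y0 r] by blast
    let ?c = "\<lambda>x. complex_of_real (cutoff r x)" and ?d = "\<lambda>x. complex_of_real (cutoff_deriv r x)"
    \<comment> \<open>The derivative of \<open>y1\<close> times the conjugate of \<phi> \<phi>
      \<open>y0\<close>, where \<phi> is the cutoff; its integral is zero.\<close>
    define p1 where "p1 x = w1 x * (cnj (y0 x) * (?c x * ?c x)) +
      y1 x * (cnj (w0 x) * (?c x * ?c x) + cnj (y0 x) * (?d x * ?c x + ?c x * ?d x))" for x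
    have AC: "AC_deriv (\<lambda>x. y1 x * (cnj (y0 x) * (?c x * ?c x))) p1"
      unfolding p1_def[abs_def] by (intro AC_deriv_mult y1 y0 AC_deriv_cnj AC_deriv_cutoff r)
    have p1: "integrable lebesgue p1" "integral\<^sup>L lebesgue p1 = 0"
      using cutoff_eq_0[of r] r by (intro AC_deriv_compact_support[OF AC, of r]; simp add: p1_def)+
    have "AE x in lebesgue. (cutoff r x * cmod (w0 x))\<^sup>2 \<le> 4 * (Re (p1 x) + 6 * p2 x) + H x"
      using eq1 eq2
    proof eventually_elim
      case (elim x)
      define q c d y w F where "q = Q x" and "c = cutoff r x" and "d = cutoff_deriv r x"
        and "y = y0 x" and "w = w0 x" and "F = f x"
      have c: "0 \<le> c" "c \<le> 1" and d: "\<bar>d\<bar> \<le> 2"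
        using cutoff_bounds cutoff_deriv_bound(2)[OF r] by (auto simp: c_def d_def)
      define a b s g where "a = c * cmod w" and "b = c * \<bar>q\<bar> * cmod y" and "s = cmod y" and "g = cmod F"
      have nn: "0 \<le> a" "0 \<le> b" "0 \<le> s" "0 \<le> g"
        using c by (auto simp: a_def b_def s_def g_def)
      \<comment> \<open>After \<open>y1\<close> is inserted into the equation the terms with
        \<open>Q\<^sup>2\<close> cancel.\<close>
      have w1: "w1 x = - F - of_real q * w"
        unfolding F_def q_def w_def elim(2) elim(1) by (simp add: algebra_simps power2_eq_square)
      have p1_eq: "p1 x = - of_real (c\<^sup>2) * (F * cnj y) - of_real (c\<^sup>2 * q) * (w * cnj y)
         + of_real (c\<^sup>2) * (w * cnj w) - of_real (c\<^sup>2 * q) * cnj (w * cnj y)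
         + of_real (2 * c * d) * (w * cnj y) - of_real (2 * c * d * q) * (y * cnj y)"
        unfolding p1_def w1 elim(1)
        by (simp add: q_def c_def d_def y_def w_def algebra_simps power2_eq_square)
      have Re_p1: "Re (p1 x) = a\<^sup>2 - c\<^sup>2 * Re (F * cnj y) - 2 * (c\<^sup>2 * q * Re (w * cnj y))
         + 2 * (c * d * Re (w * cnj y)) - 2 * (c * d * q * s\<^sup>2)"
        unfolding p1_eq a_def s_def power_mult_distrib cmod_power2
        by (simp add: power2_eq_square algebra_simps)
      have Rew: "\<bar>Re (w * cnj y)\<bar> \<le> cmod w * s"
        using abs_Re_le_cmod[of "w * cnj y"] by (simp add: norm_mult s_def)
      have 1: "c\<^sup>2 * Re (F * cnj y) \<le> g * s"
      proof -
        have "c\<^sup>2 * Re (F * cnj y) \<le> c\<^sup>2 * (g * s)"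
          using complex_Re_le_cmod[of "F * cnj y"] by (intro mult_left_mono) (auto simp: norm_mult g_def s_def)
        also have "\<dots> \<le> g * s"
          using c nn by (intro mult_left_le_one_le) (auto simp: power_le_one)
        finally show ?thesis .
      qed
      have 2: "c\<^sup>2 * q * Re (w * cnj y) \<le> a * b"
      proof -
        have "c\<^sup>2 * q * Re (w * cnj y) \<le> \<bar>c\<^sup>2 * q\<bar> * \<bar>Re (w * cnj y)\<bar>"
          by (metis abs_ge_self abs_mult)
        also have "\<dots> \<le> \<bar>c\<^sup>2 * q\<bar> * (cmod w * s)"
          using Rew by (intro mult_left_mono) auto
        also have "\<dots> = a * b"
          using c by (simp add: a_def b_def s_def power2_eq_square abs_mult)
        finally show ?thesis .
      qed
      have 3: "- (c * d * Re (w * cnj y)) \<le> 2 * (a * s)"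
      proof -
        have "- (c * d * Re (w * cnj y)) \<le> c * \<bar>d\<bar> * \<bar>Re (w * cnj y)\<bar>"
          using c by (metis abs_ge_minus_self abs_mult abs_of_nonneg)
        also have "\<dots> \<le> c * 2 * (cmod w * s)"
          using Rew d c by (intro mult_mono mult_left_mono) auto
        finally show ?thesis by (simp add: a_def)
      qed
      have 4: "c * d * q * s\<^sup>2 \<le> 2 * (b * s)"
      proof -
        have "c * d * q * s\<^sup>2 \<le> \<bar>d\<bar> * (c * \<bar>q\<bar> * s\<^sup>2)"
          using c abs_ge_self[of "c * d * q * s\<^sup>2"] by (simp add: abs_mult mult_ac)
        also have "\<dots> \<le> 2 * (c * \<bar>q\<bar> * s\<^sup>2)"
          using d c by (intro mult_right_mono) auto
        finally show ?thesis by (simp add: b_def s_def power2_eq_square)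
      qed
      have I1: "a\<^sup>2 \<le> Re (p1 x) + g * s + 2 * (a * b) + 4 * (a * s) + 4 * (b * s)"
        using Re_p1 1 2 3 4 by linarith
      have I2: "b\<^sup>2 \<le> p2 x + K * s\<^sup>2 + 2 * (B * s * a) + 4 * (B * s\<^sup>2)"
        using p2(3)[of x] by (simp add: a_def b_def s_def q_def c_def y_def w_def mult.assoc algebra_simps power2_eq_square)
      \<comment> \<open>These squares, the fourth one taken twice, bound the products in
        \<open>I1\<close> by \<open>3 / 4 * a\<^sup>2\<close>, \<open>6 * b\<^sup>2\<close> and
        terms in \<open>g\<^sup>2\<close> and \<open>s\<^sup>2\<close>, once \<open>I2\<close> is
        used for \<open>b\<^sup>2\<close>. A quarter of \<open>a\<^sup>2\<close> survives on the
        left, whence the factor 4 in \<open>H\<close>.\<close>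
      have "0 \<le> (g - s / 2)\<^sup>2" "0 \<le> (a / 2 - 2 * b)\<^sup>2" "0 \<le> (a / 2 - 4 * s)\<^sup>2" "0 \<le> (b - s)\<^sup>2"
        "0 \<le> (a / 2 - 12 * (B * s))\<^sup>2" by simp_all
      then have "a\<^sup>2 / 4 \<le> Re (p1 x) + 6 * p2 x + g\<^sup>2 + C * s\<^sup>2"
        using I1 I2 by (simp add: C_def power2_eq_square algebra_simps)
      then show ?case
        by (simp add: H_def a_def s_def g_def c_def w_def y_def F_def)
    qed
    then show "\<exists>G. integrable lebesgue G \<and> integral\<^sup>L lebesgue G \<le> integral\<^sup>L lebesgue H \<and>
        (AE x in lebesgue. (cutoff r x * cmod (w0 x))\<^sup>2 \<le> G x)"
      using p1 p2 H integral_Re[OF p1(1)]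
      by (intro exI[of _ "\<lambda>x. 4 * (Re (p1 x) + 6 * p2 x) + H x"]) auto
  qed
qed

text \<open>Once \<open>w0\<close> is in L2, all integrals of the form converge absolutely, and the
  equation tested against cutoffs of \<open>v\<close> passes to the limit.\<close>

lemma Smax_subset_Sform: "Smax_graph Q \<subseteq> Sform_graph Q"
proof clarify
  fix u f assume "(u, f) \<in> Smax_graph Q"
  then obtain y0 w0 y1 w1 where L2: "L2 u" "L2 f" and y0: "AC_deriv y0 w0" and y1: "AC_deriv y1 w1"
    and u: "AE x in lebesgue. u x = y0 x"
    and eq1: "AE x in lebesgue. y1 x = w0 x - of_real (Q x) * y0 x"
    and eq2: "AE x in lebesgue. f x = - w1 x - of_real (Q x) * y1 x - (of_real (Q x))\<^sup>2 * y0 x"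
    by (auto simp: Smax_graph_def)
  have "L2 w0"
    using Smax_derivative_L2[OF y0 y1 L2_cong_AE[OF L2(1) u] L2(2) eq1 eq2] .
  with L2 y0 u have H1u: "H1_deriv u w0"
    by (auto simp: H1_deriv_def)
  have "tau Q u w0 v v' = ip f v" if v: "H1_deriv v v'" for v v'
  proof -
    obtain z where z: "AC_deriv z v'" and vz: "AE x in lebesgue. v x = z x" and L2v: "L2 v" "L2 v'"
      using v by (auto simp: H1_deriv_def)
    note Qu = L2_potential_mult[OF H1u]
    \<comment> \<open>The potential is moved onto \<open>v\<close>, because only \<open>Q v\<close>,
      and not \<open>Q w0\<close>, is known to be in L2.\<close>
    note Qv = L2_cnj[OF L2_potential_mult[OF v]]
    note w0v' = L2_mult_integrable[OF \<open>L2 w0\<close> L2_cnj[OF L2v(2)]]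
    note Quv' = L2_mult_integrable[OF Qu L2_cnj[OF L2v(2)]]
    note Qw0v = L2_mult_integrable[OF \<open>L2 w0\<close> Qv]
    note fv = L2_mult_integrable[OF L2(2) L2_cnj[OF L2v(1)]]
    note dv = L2_mult_integrable[OF L2_diff[OF \<open>L2 w0\<close> Qu] L2_cnj[OF L2v(1)]]
    \<comment> \<open>The integrand of \<open>tau Q u w0 v v' - ip f v\<close>; \<open>k\<close>
      below is the factor that meets the derivative of the cutoff.\<close>
    define h where "h x = w0 x * cnj (v' x) - of_real (Q x) * u x * cnj (v' x)
       - w0 x * cnj (of_real (Q x) * v x) - f x * cnj (v x)" for x
    define k where "k x = (w0 x - of_real (Q x) * u x) * cnj (v x)" for x
    have h: "integrable lebesgue h" and k: "integrable lebesgue k"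
      unfolding h_def k_def by (intro Bochner_Integration.integrable_diff w0v' Quv' Qw0v fv dv)+
    define p where "p r x = of_real (cutoff r x) * h x + of_real (cutoff_deriv r x) * k x" for r x
    have pm: "p r \<in> borel_measurable lebesgue" for r
    proof -
      have "cutoff r \<in> borel_measurable lebesgue" "cutoff_deriv r \<in> borel_measurable lebesgue"
        unfolding cutoff_def cutoff_deriv_def by (intro measurable_completion; measurable)+
      then show ?thesis
        using h k unfolding p_def by measurable
    qed
    have p0: "integral\<^sup>L lebesgue (p r) = 0" if r: "1 \<le> r" for r
    proof -
      let ?c = "\<lambda>x. complex_of_real (cutoff r x)" and ?d = "\<lambda>x. complex_of_real (cutoff_deriv r x)"
      let ?p = "\<lambda>x. w1 x * (cnj (z x) * ?c x) + y1 x * (cnj (v' x) * ?c x + cnj (z x) * ?d x)"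
      have AC: "AC_deriv (\<lambda>x. y1 x * (cnj (z x) * ?c x)) ?p"
        by (intro AC_deriv_mult y1 z AC_deriv_cnj AC_deriv_cutoff r)
      have p: "integrable lebesgue ?p" "integral\<^sup>L lebesgue ?p = 0"
        using cutoff_eq_0[of r] r by (intro AC_deriv_compact_support[OF AC, of r]; simp)+
      \<comment> \<open>The equation identifies \<open>p r\<close> with the derivative of the
        compactly supported product of \<open>y1\<close>, the conjugate of \<open>z\<close> and the
        cutoff.\<close>
      have "AE x in lebesgue. p r x = ?p x"
        using eq1 eq2 u vz
      proof eventually_elim
        case (elim x)
        have w1: "w1 x = - f x - of_real (Q x) * w0 x"
          unfolding elim(2) elim(1) by (simp add: algebra_simps power2_eq_square)
        show ?case
          unfolding w1 elim(1) by (simp add: p_def h_def k_def elim(3,4) algebra_simps)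
      qed
      then have "integral\<^sup>L lebesgue (p r) = integral\<^sup>L lebesgue ?p"
        using p(1) pm by (intro integral_cong_AE) auto
      then show ?thesis using p(2) by simp
    qed
    have "(\<lambda>n. integral\<^sup>L lebesgue (p (real (Suc n)))) \<longlonglongrightarrow> integral\<^sup>L lebesgue h"
    proof (rule integral_dominated_convergence)
      show "h \<in> borel_measurable lebesgue" using h by auto
      show "integrable lebesgue (\<lambda>x. cmod (h x) + 2 * cmod (k x))"
        using h k by auto
      show "AE x in lebesgue. (\<lambda>n. p (real (Suc n)) x) \<longlonglongrightarrow> h x"
      proof (intro AE_I2)
        fix x
        have "(\<lambda>n. p (real (Suc n)) x) \<longlonglongrightarrow> of_real 1 * h x + of_real 0 * k x"
          unfolding p_def by (intro tendsto_intros cutoff_tendsto cutoff_deriv_tendsto)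
        then show "(\<lambda>n. p (real (Suc n)) x) \<longlonglongrightarrow> h x" by simp
      qed
      show "AE x in lebesgue. norm (p (real (Suc n)) x) \<le> cmod (h x) + 2 * cmod (k x)" for n
      proof (intro AE_I2)
        fix x
        have "norm (p (real (Suc n)) x) \<le> cutoff (real (Suc n)) x * cmod (h x) + \<bar>cutoff_deriv (real (Suc n)) x\<bar> * cmod (k x)"
          unfolding p_def by (rule order_trans[OF norm_triangle_ineq]) (simp only: norm_mult norm_of_real abs_of_nonneg[OF cutoff_bounds(1)])
        also have "\<dots> \<le> 1 * cmod (h x) + 2 * cmod (k x)"
          by (intro add_mono mult_right_mono cutoff_bounds cutoff_deriv_bound) auto
        finally show "norm (p (real (Suc n)) x) \<le> cmod (h x) + 2 * cmod (k x)" by simp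
      qed
    qed (rule pm)
    then have "integral\<^sup>L lebesgue h = 0"
      using p0 by (simp add: LIMSEQ_const_iff)
    moreover have "integral\<^sup>L lebesgue h = tau Q u w0 v v' - ip f v"
      unfolding h_def
      by (subst Bochner_Integration.integral_diff, (intro Bochner_Integration.integrable_diff w0v' Quv' Qw0v fv)+)+
        (simp add: tau_def ip_def mult_ac)
    ultimately show ?thesis by simp
  qed
  with L2(2) H1u show "(u, f) \<in> Sform_graph Q"
    by (auto simp: Sform_graph_def)
qed

end

section \<open>Local square integrability and compactly supported test functions\<close>

lemma L2_continuous_Icc:
  assumes "continuous_on UNIV y"
  shows "L2 (\<lambda>x. indicator {a..b} x * y x)"
  unfolding L2_def
proof
  show "(\<lambda>x. indicator {a..b} x * y x) \<in> borel_measurable lebesgue"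
    using borel_measurable_continuous_onI[OF assms] by (intro measurable_completion) measurable
  have "(\<lambda>x. (cmod (y x))\<^sup>2) absolutely_integrable_on {a..b}"
    using assms by (intro absolutely_integrable_continuous_real continuous_intros) (auto intro: continuous_on_subset)
  moreover have "indicator {a..b} x *\<^sub>R (cmod (y x))\<^sup>2 = (cmod (indicator {a..b} x * y x))\<^sup>2" for x
    by (auto simp: indicator_def)
  ultimately show "integrable lebesgue (\<lambda>x. (cmod (indicator {a..b} x * y x))\<^sup>2)"
    by (simp add: set_integrable_def)
qed

lemma L2_indicator: "L2 (indicator {a..b})"
  using L2_continuous_Icc[of "\<lambda>x. 1" a b] by simp

lemma L2_mult_absolutely_integrable:
  assumes "L2 (\<lambda>x. indicator {a..b} x * f x)" "L2 g"
  shows "(\<lambda>x. f x * g x) absolutely_integrable_on {a..b}"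
proof -
  have "indicator {a..b} x *\<^sub>R (f x * g x) = indicator {a..b} x * f x * g x" for x
    by (auto simp: indicator_def)
  then show ?thesis
    using L2_mult_integrable[OF assms] by (simp add: set_integrable_def)
qed

lemma L2_restrict:
  assumes "L2 f" "S \<in> sets lebesgue"
  shows "L2 (\<lambda>x. indicator S x * f x)"
proof (rule L2_bound[OF _ L2_square_integrable[OF assms(1)]])
  show "(\<lambda>x. indicator S x * f x) \<in> borel_measurable lebesgue"
    using L2_measurable[OF assms(1)] assms(2) by measurable
qed (auto simp: indicator_def)

text \<open>The primitive that starts from 0 at \<open>- r\<close> returns to 0 at \<open>r\<close>
  because \<open>h\<close> has mean zero.\<close>

lemma H1_primitive:
  assumes h: "L2 h" "\<And>x. r \<le> \<bar>x\<bar> \<Longrightarrow> h x = 0" "integral\<^sup>L lebesgue h = 0" and "0 < r"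
  obtains v where "H1_deriv v h" "AC_deriv v h" "\<And>x. r \<le> \<bar>x\<bar> \<Longrightarrow> v x = 0"
proof -
  have habs: "h absolutely_integrable_on {a..b}" for a b
    using L2_mult_absolutely_integrable[of a b "\<lambda>x. 1" h] L2_indicator h(1) by simp
  obtain v0 where v0: "AC_deriv v0 h"
    using AC_deriv_exists[OF habs] by blast
  define v where "v x = v0 x + (- v0 (-r))" for x
  have v: "AC_deriv v h"
    using AC_deriv_add[OF v0 AC_deriv_const[of "- v0 (-r)"]] unfolding v_def[abs_def] by simp
  have supp: "v x = 0" if "r \<le> \<bar>x\<bar>" for x
  proof (cases "x \<le> 0")
    case True
    then have x: "x \<le> - r" using that by auto
    have "(h has_integral 0) {x..-r}"
      using h(2) x \<open>0 < r\<close> by (intro has_integral_is_0) auto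
    then have "v (-r) - v x = 0"
      using AC_derivD(3)[OF v x] has_integral_unique by blast
    then show ?thesis by (simp add: v_def)
  next
    case False
    then have x: "r \<le> x" using that by auto
    have "(\<lambda>x. indicator {-r..r} x *\<^sub>R h x) = h"
      using h(2) by (force simp: fun_eq_iff indicator_def)
    then have "integrable lebesgue h"
      using habs[of "-r" r] by (simp add: set_integrable_def)
    from has_integral_integral_lebesgue[OF this] have "(h has_integral 0) UNIV"
      using h(3) by simp
    moreover have "(h has_integral (v x - v (-r))) UNIV"
      by (rule has_integral_on_superset[OF AC_derivD(3)[OF v, of "-r" x]]) (use h(2) x \<open>0 < r\<close> in auto)
    ultimately have "v x - v (-r) = 0"
      using has_integral_unique by blast
    then show ?thesis by (simp add: v_def)
  qed
  have "(\<lambda>x. indicator {-r..r} x * v x) = v"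
    using supp by (force simp: fun_eq_iff indicator_def)
  then have "L2 v"
    using L2_continuous_Icc[OF AC_deriv_continuous[OF v], of "-r" r] by simp
  then have "H1_deriv v h"
    using v h(1) by (auto simp: H1_deriv_def)
  then show ?thesis
    using that v supp by blast
qed

section \<open>From the form identity back to the differential equation\<close>

context periodic_potential
begin

lemma L2_potential_Icc: "L2 (\<lambda>x. indicator {a..b} x * of_real (Q x))"
  unfolding L2_def
proof
  have "(\<lambda>x. complex_of_real (Q x)) \<in> borel_measurable lebesgue"
    using measurable by measurable
  then show "(\<lambda>x. indicator {a..b} x * complex_of_real (Q x)) \<in> borel_measurable lebesgue"
    by (intro borel_measurable_times borel_measurable_indicator) auto
  have "indicator {a..b} x *\<^sub>R (Q x)\<^sup>2 = (cmod (indicator {a..b} x * complex_of_real (Q x)))\<^sup>2" for x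
    by (auto simp: indicator_def)
  then show "integrable lebesgue (\<lambda>x. (cmod (indicator {a..b} x * complex_of_real (Q x)))\<^sup>2)"
    using square_integrable_Icc[of a b] by (simp add: set_integrable_def)
qed

text \<open>The argument of du Bois-Reymond: every mean-zero \<open>h\<close> of compact support is the derivative of
  an admissible test function, so \<open>u' - Q u + F\<close> is orthogonal to all such \<open>h\<close>, where \<open>F' = f + Q u'\<close>.\<close>

lemma Sform_subset_Smax: "Sform_graph Q \<subseteq> Smax_graph Q"
proof clarify
  fix u f assume "(u, f) \<in> Sform_graph Q"
  then obtain u' where L2f: "L2 f" and H1u: "H1_deriv u u'"
    and form: "\<And>v v'. H1_deriv v v' \<Longrightarrow> tau Q u u' v v' = ip f v"
    by (auto simp: Sform_graph_def)
  obtain y0 where L2u: "L2 u" "L2 u'" and y0: "AC_deriv y0 u'" and uy0: "AE x in lebesgue. u x = y0 x"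
    using H1u by (auto simp: H1_deriv_def)
  define W where "W x = f x + of_real (Q x) * u' x" for x
  have "W absolutely_integrable_on {a..b}" for a b
    using L2_mult_absolutely_integrable[of a b "\<lambda>x. 1" f] L2_indicator L2f
      L2_mult_absolutely_integrable[OF L2_potential_Icc L2u(2)]
    unfolding W_def[abs_def] by (intro set_integral_add(1)) simp_all
  then obtain F where F: "AC_deriv F W"
    using AC_deriv_exists by blast
  note Qu = L2_potential_mult[OF H1u]
  define G where "G x = u' x - of_real (Q x) * u x + F x" for x
  have orth: "integrable lebesgue (\<lambda>x. G x * cnj (h x)) \<and> integral\<^sup>L lebesgue (\<lambda>x. G x * cnj (h x)) = 0"
    if h: "L2 h" "\<And>x. r \<le> \<bar>x\<bar> \<Longrightarrow> h x = 0" "integral\<^sup>L lebesgue h = 0" "0 < r" for h r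
  proof -
    obtain v where H1v: "H1_deriv v h" and v: "AC_deriv v h" and supp: "\<And>x. r \<le> \<bar>x\<bar> \<Longrightarrow> v x = 0"
      using H1_primitive[OF h] by blast
    have L2v: "L2 v" using H1v by (simp add: H1_deriv_def)
    note i1 = L2_mult_integrable[OF L2u(2) L2_cnj[OF h(1)]]
    note i2 = L2_mult_integrable[OF Qu L2_cnj[OF h(1)]]
    note i3 = L2_mult_integrable[OF L2u(2) L2_cnj[OF L2_potential_mult[OF H1v]]]
    note i4 = L2_mult_integrable[OF L2f L2_cnj[OF L2v]]
    define p where "p x = W x * cnj (v x) + F x * cnj (h x)" for x
    define q where "q x = u' x * cnj (h x) - of_real (Q x) * u x * cnj (h x)
      - u' x * cnj (of_real (Q x) * v x) - f x * cnj (v x)" for x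
    have AC: "AC_deriv (\<lambda>x. F x * cnj (v x)) p"
      unfolding p_def[abs_def] by (intro AC_deriv_mult F AC_deriv_cnj v)
    have p: "integrable lebesgue p" "integral\<^sup>L lebesgue p = 0"
      using supp h(2) by (intro AC_deriv_compact_support[OF AC, of r]; simp add: p_def)+
    have q: "integrable lebesgue q"
      unfolding q_def by (intro Bochner_Integration.integrable_diff i1 i2 i3 i4)
    have "integral\<^sup>L lebesgue q = tau Q u u' v h - ip f v"
      unfolding q_def
      by (subst Bochner_Integration.integral_diff, (intro Bochner_Integration.integrable_diff i1 i2 i3 i4)+)+
        (simp add: tau_def ip_def mult_ac)
    then have "integral\<^sup>L lebesgue q = 0"
      using form[OF H1v] by simp
    \<comment> \<open>The terms containing \<open>v\<close> cancel between \<open>q\<close> and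
      \<open>p\<close>; only those with \<open>v' = h\<close> remain.\<close>
    have "(\<lambda>x. G x * cnj (h x)) = (\<lambda>x. q x + p x)"
      by (simp add: fun_eq_iff q_def p_def G_def W_def algebra_simps)
    then show ?thesis
      using p q \<open>integral\<^sup>L lebesgue q = 0\<close> by simp
  qed
  have L2G: "L2 (\<lambda>x. indicator {a..b} x * G x)" for a b
  proof -
    have "L2 (\<lambda>x. indicator {a..b} x * (u' x - of_real (Q x) * u x) + indicator {a..b} x * F x)"
      by (intro L2_add L2_restrict L2_diff L2u Qu L2_continuous_Icc AC_deriv_continuous[OF F]) simp
    then show ?thesis
      by (simp add: G_def algebra_simps)
  qed
  define I where "I = (indicator {0..1} :: real \<Rightarrow> complex)"
  have I: "L2 I" "integrable lebesgue I" "integral\<^sup>L lebesgue I = 1"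
  proof -
    show "L2 I"
      unfolding I_def by (rule L2_indicator)
    have I_real: "I = (\<lambda>x. complex_of_real (indicator {0..1} x))"
      by (auto simp: I_def fun_eq_iff indicator_def)
    show "integrable lebesgue I" "integral\<^sup>L lebesgue I = 1"
      unfolding I_real by (simp_all add: integrable_indicator_iff)
  qed
  have IG: "integrable lebesgue (\<lambda>x. I x * G x)"
  proof -
    have "(\<lambda>x. I x * (indicator {0..1} x * G x)) = (\<lambda>x. I x * G x)"
      by (auto simp: I_def fun_eq_iff indicator_def)
    then show ?thesis
      using L2_mult_integrable[OF I(1) L2G[of 0 1]] by simp
  qed
  \<comment> \<open>The mean of \<open>G\<close> over the unit interval, the only candidate for its
    constant value.\<close>
  define c where "c = integral\<^sup>L lebesgue (\<lambda>x. I x * G x)"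
  have "AE x in lebesgue. \<bar>x\<bar> < r \<longrightarrow> G x = c" if r: "2 \<le> r" for r :: real
  proof -
    \<comment> \<open>The open interval makes \<open>h\<close> below vanish at distance exactly
      \<open>r\<close>, and \<open>2 \<le> r\<close> keeps the support of \<open>I\<close> inside
      it.\<close>
    define D where "D x = indicator {-r<..<r} x * (G x - c)" for x
    have "L2 (\<lambda>x. indicator {-r<..<r} x * (indicator {-r..r} x * G x - c * indicator {-r..r} x))"
      using L2_continuous_Icc[of "\<lambda>x. c" "-r" r]
      by (intro L2_restrict L2_diff L2G) (simp_all add: mult.commute)
    moreover have "(\<lambda>x. indicator {-r<..<r} x * (indicator {-r..r} x * G x - c * indicator {-r..r} x)) = D"
      by (auto simp: D_def fun_eq_iff indicator_def)
    ultimately have L2D: "L2 D" by simp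
    have "(\<lambda>x. indicator {-r..r} x * D x) = D"
      by (auto simp: fun_eq_iff D_def indicator_def)
    then have intD: "integrable lebesgue D"
      using L2_mult_integrable[OF L2_indicator[of "-r" r] L2D] by simp
    define d where "d = integral\<^sup>L lebesgue D"
    \<comment> \<open>Subtracting \<open>d * I\<close> corrects the mean of \<open>D\<close> to
      zero, since \<open>I\<close> has integral 1.\<close>
    define h where "h x = D x - d * I x" for x
    have dI: "L2 (\<lambda>x. d * I x)"
      using L2_continuous_Icc[of "\<lambda>x. d" 0 1] by (simp add: I_def mult.commute)
    have h: "L2 h" "integrable lebesgue h" "integral\<^sup>L lebesgue h = 0"
      using intD I L2D dI unfolding h_def by (auto intro: L2_diff simp: d_def)
    have "h x = 0" if "r \<le> \<bar>x\<bar>" for x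
      using that r by (auto simp: h_def D_def I_def indicator_def)
    with h have Gh: "integrable lebesgue (\<lambda>x. G x * cnj (h x))" "integral\<^sup>L lebesgue (\<lambda>x. G x * cnj (h x)) = 0"
      using orth[of h r] r by auto
    have D2: "integrable lebesgue (\<lambda>x. (cmod (D x))\<^sup>2)"
      using L2D by (rule L2_square_integrable)
    \<comment> \<open>This is \<open>(G x - c) * cnj (D x)\<close> with
      \<open>D = h + d * I\<close>. On integration the terms with \<open>h\<close> vanish and those
      with \<open>d\<close> cancel, because \<open>c\<close> is the integral of
      \<open>I * G\<close>; so \<open>D\<close> is zero almost everywhere.\<close>
    have "complex_of_real ((cmod (D x))\<^sup>2) = G x * cnj (h x) - c * cnj (h x) + cnj d * (I x * G x) - cnj d * c * I x" for x
    proof -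
      have "complex_of_real ((cmod (D x))\<^sup>2) = (G x - c) * cnj (D x)"
        unfolding complex_norm_square by (simp add: D_def indicator_def)
      moreover have "cnj (I x) = I x" by (simp add: I_def indicator_def)
      ultimately show ?thesis by (simp add: h_def algebra_simps)
    qed
    then have "(\<lambda>x. complex_of_real ((cmod (D x))\<^sup>2)) =
      (\<lambda>x. G x * cnj (h x) - c * cnj (h x) + cnj d * (I x * G x) - cnj d * c * I x)" by blast
    then have "integral\<^sup>L lebesgue (\<lambda>x. complex_of_real ((cmod (D x))\<^sup>2)) =
      0 - c * cnj (integral\<^sup>L lebesgue h) + cnj d * c - cnj d * c * 1"
      using Gh h I IG by (simp add: c_def)
    then have "complex_of_real (integral\<^sup>L lebesgue (\<lambda>x. (cmod (D x))\<^sup>2)) = 0"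
      using h(3) by (simp only: integral_complex_of_real) simp
    then have "AE x in lebesgue. (cmod (D x))\<^sup>2 = 0"
      using integral_nonneg_eq_0_iff_AE[OF D2] by simp
    then show ?thesis
      by eventually_elim (auto simp: D_def indicator_def abs_less_iff split: if_splits)
  qed
  then have "AE x in lebesgue. \<forall>n. \<bar>x\<bar> < real n + 2 \<longrightarrow> G x = c"
    unfolding AE_all_countable by simp
  then have Gc: "AE x in lebesgue. G x = c"
  proof eventually_elim
    case (elim x)
    obtain n where "\<bar>x\<bar> \<le> real n" using real_arch_simple by blast
    with elim show ?case by (metis add.commute add_strict_increasing zero_less_numeral)
  qed
  \<comment> \<open>The representative of \<open>u' - Q u\<close> is \<open>c - F\<close>, because
    \<open>G = c\<close> almost everywhere.\<close>
  have y1: "AC_deriv (\<lambda>x. c + - F x) (\<lambda>x. 0 + - W x)"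
    by (intro AC_deriv_add AC_deriv_const AC_deriv_linear[OF F]) (rule bounded_linear_minus[OF bounded_linear_ident])
  have "AE x in lebesgue. c + - F x = u' x - of_real (Q x) * y0 x"
    using Gc uy0 by eventually_elim (auto simp: G_def)
  moreover have "AE x in lebesgue. f x = - (0 + - W x) - of_real (Q x) * (c + - F x) - (of_real (Q x))\<^sup>2 * y0 x"
    using Gc uy0
  proof eventually_elim
    case (elim x)
    then have c: "c = u' x - of_real (Q x) * y0 x + F x" by (simp add: G_def)
    show ?case by (simp add: c W_def algebra_simps power2_eq_square)
  qed
  ultimately show "(u, f) \<in> Smax_graph Q"
    using L2u(1) L2f y0 y1 uy0 unfolding Smax_graph_def by blast
qed

end

theorem theorem3p14:
  fixes qh :: "int \<Rightarrow> complex" and Q :: "real \<Rightarrow> real"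
  assumes "Hm1_per_real qh"
    and "qh 0 = 0"
    and "is_Q qh Q"
  shows "Smax_graph Q = Sform_graph Q"
proof -
  interpret periodic_potential Q
    using assms(3) by unfold_locales (auto simp: is_Q_def)
  show ?thesis
    using Smax_subset_Sform Sform_subset_Smax by (rule subset_antisym)
qed

end
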